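(* Let $\omega\in(0,1/2)$ and, for $\delta\in[0,3)$, let $\lambda_\delta(n)=\delta+n^2$ be the eigenvalues of the screened Poisson operator $\mathcal{L}_\delta=\delta I-\Delta$ with $2\pi$-periodic boundary conditions. Let $$F(N;\delta,\omega)=\sum_{m=1}^\infty\frac{1}{\lambda_\delta(mN)}\left(\frac{\sin(m\pi\omega)}{m}\right)^2,\qquad \Delta_NF(N;\delta,\omega)=F(N+1;\delta,\omega)-F(N;\delta,\omega),$$ and for $\gamma>0$ let $N^*(\gamma,\delta)$ be the largest minimizer over $N\in\mathbb{Z}^+$ of $2N+\frac{2\gamma}{\pi}F(N;\delta,\omega)$. If $\delta\in(0,3)$, then the screening parameter $\delta$ both instantly and cumulatively demotes the bubble splitting.
   Context: Write $N^*=N^*(\gamma,\delta)$. "$\delta$ instantly demotes the bubble splitting" means: for all $\gamma>0$ and all $\delta\in(0,3)$, $\frac{\partial}{\partial\delta}\Delta_NF(N;\delta,\omega)\ge0$ at $N=N^*-1$ and $N=N^*$ (the condition at $N^*-1$ being void if $N^*=1$), namely $N^*(\gamma,\delta)$ is nonincreasing in $\delta$. "$\delta$ cumulatively demotes the bubble splitting" means: for all $\gamma>0$ and all $\delta\in(0,3)$, $\Delta_NF(N;\delta,\omega)-\Delta_NF(N;0,\omega)\ge0$ at $N=N^*-1$ and $N=N^*$ (same convention if $N^*=1$), namely $N^*(\gamma,\delta)\le N^*(\gamma,0)$. *)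

theory Defs
  imports "HOL-Analysis.Analysis"
begin

definition screened_poisson :: "real \<Rightarrow> (real \<Rightarrow> real) \<Rightarrow> real \<Rightarrow> real" where
  "screened_poisson \<delta> u x = \<delta> * u x - deriv (deriv u) x"

definition eigval :: "real \<Rightarrow> nat \<Rightarrow> real" where
  "eigval \<delta> n = \<delta> + (real n)\<^sup>2"

text \<open>
  For natural \<open>n\<close>, \<open>eigval \<delta> n\<close> is the eigenvalue of \<open>screened_poisson \<delta>\<close> on the \<open>2\<pi>\<close>-periodic
  functions belonging to \<open>cos (n x)\<close> and \<open>sin (n x)\<close>.
\<close>

lemma screened_poisson_cos:
  "screened_poisson \<delta> (\<lambda>x. cos (real n * x)) x = eigval \<delta> n * cos (real n * x)"
proof -
  have "deriv (\<lambda>x. cos (real n * x)) = (\<lambda>x. - (real n * sin (real n * x)))"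
    by (intro ext DERIV_imp_deriv) (auto intro!: derivative_eq_intros)
  moreover have "deriv (\<lambda>x. - (real n * sin (real n * x))) x = - ((real n)\<^sup>2 * cos (real n * x))"
    by (intro DERIV_imp_deriv) (auto intro!: derivative_eq_intros simp: power2_eq_square)
  ultimately show ?thesis
    by (simp add: screened_poisson_def eigval_def algebra_simps)
qed

lemma screened_poisson_sin:
  "screened_poisson \<delta> (\<lambda>x. sin (real n * x)) x = eigval \<delta> n * sin (real n * x)"
proof -
  have "deriv (\<lambda>x. sin (real n * x)) = (\<lambda>x. real n * cos (real n * x))"
    by (intro ext DERIV_imp_deriv) (auto intro!: derivative_eq_intros)
  moreover have "deriv (\<lambda>x. real n * cos (real n * x)) x = - ((real n)\<^sup>2 * sin (real n * x))"
    by (intro DERIV_imp_deriv) (auto intro!: derivative_eq_intros simp: power2_eq_square)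
  ultimately show ?thesis
    by (simp add: screened_poisson_def eigval_def algebra_simps)
qed

text \<open>The sum over $m \ge 1$ is written with \<open>Suc m\<close> because \<open>suminf\<close> starts at \<open>0\<close>.\<close>

definition bubbleF :: "nat \<Rightarrow> real \<Rightarrow> real \<Rightarrow> real" where
  "bubbleF N \<delta> \<omega> =
     (\<Sum>m. 1 / eigval \<delta> (Suc m * N) * (sin (real (Suc m) * pi * \<omega>) / real (Suc m))\<^sup>2)"

definition DeltaF :: "nat \<Rightarrow> real \<Rightarrow> real \<Rightarrow> real" where
  "DeltaF N \<delta> \<omega> = bubbleF (N + 1) \<delta> \<omega> - bubbleF N \<delta> \<omega>"

definition energy :: "real \<Rightarrow> real \<Rightarrow> real \<Rightarrow> nat \<Rightarrow> real" where
  "energy \<omega> \<gamma> \<delta> N = 2 * real N + 2 * \<gamma> / pi * bubbleF N \<delta> \<omega>"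

definition Nstar :: "real \<Rightarrow> real \<Rightarrow> real \<Rightarrow> nat" where
  "Nstar \<omega> \<gamma> \<delta> = (GREATEST N. is_arg_min (energy \<omega> \<gamma> \<delta>) (\<lambda>N. 1 \<le> N) N)"

text \<open>
  Both notions below include, besides the inequalities on \<open>DeltaF\<close>, the resulting monotonicity
  of \<open>Nstar\<close>. The partial derivative in \<open>\<delta>\<close> is required to exist. The guard
  \<open>1 < Nstar \<omega> \<gamma> \<delta>\<close> makes the condition at \<open>Nstar \<omega> \<gamma> \<delta> - 1\<close> void when \<open>Nstar \<omega> \<gamma> \<delta> = 1\<close>.
\<close>

definition instantly_demotes :: "real \<Rightarrow> bool" where
  "instantly_demotes \<omega> \<longleftrightarrow>
     (\<forall>\<gamma>>0.
        (\<forall>\<delta>\<in>{0<..<3}.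
           (1 < Nstar \<omega> \<gamma> \<delta> \<longrightarrow>
              (\<exists>D\<ge>0. ((\<lambda>d. DeltaF (Nstar \<omega> \<gamma> \<delta> - 1) d \<omega>) has_real_derivative D) (at \<delta>))) \<and>
           (\<exists>D\<ge>0. ((\<lambda>d. DeltaF (Nstar \<omega> \<gamma> \<delta>) d \<omega>) has_real_derivative D) (at \<delta>))) \<and>
        antimono_on {0<..<3} (Nstar \<omega> \<gamma>))"

definition cumulatively_demotes :: "real \<Rightarrow> bool" where
  "cumulatively_demotes \<omega> \<longleftrightarrow>
     (\<forall>\<gamma>>0. \<forall>\<delta>\<in>{0<..<3}.
        (1 < Nstar \<omega> \<gamma> \<delta> \<longrightarrow>
           DeltaF (Nstar \<omega> \<gamma> \<delta> - 1) \<delta> \<omega> - DeltaF (Nstar \<omega> \<gamma> \<delta> - 1) 0 \<omega> \<ge> 0) \<and>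
        DeltaF (Nstar \<omega> \<gamma> \<delta>) \<delta> \<omega> - DeltaF (Nstar \<omega> \<gamma> \<delta>) 0 \<omega> \<ge> 0 \<and>
        Nstar \<omega> \<gamma> \<delta> \<le> Nstar \<omega> \<gamma> 0)"

lemma summable_bubbleF:
  assumes "0 \<le> \<delta>" "1 \<le> N"
  shows "summable (\<lambda>m. 1 / eigval \<delta> (Suc m * N) * (sin (real (Suc m) * pi * \<omega>) / real (Suc m))\<^sup>2)"
proof (rule summable_comparison_test')
  show "summable (\<lambda>m. inverse ((real (Suc m))\<^sup>2))"
    using summable_Suc_iff[of "\<lambda>m. inverse ((real m)\<^sup>2)"] inverse_power_summable[of 2, where 'a = real]
    by simp
  fix m :: nat
  let ?s = "sin (real (Suc m) * pi * \<omega>)"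
  have "1 * 1 \<le> real (Suc m) * real N"
    using assms by (intro mult_mono) auto
  then have "1 \<le> eigval \<delta> (Suc m * N)"
    using assms one_le_power[of "real (Suc m) * real N" 2] unfolding eigval_def of_nat_mult by linarith
  then have A: "0 \<le> 1 / eigval \<delta> (Suc m * N)" "1 / eigval \<delta> (Suc m * N) \<le> 1" by auto
  have B: "?s\<^sup>2 \<le> 1" by (simp add: abs_square_le_1)
  have "1 / eigval \<delta> (Suc m * N) * (?s / real (Suc m))\<^sup>2 \<le> 1 * (?s / real (Suc m))\<^sup>2"
    by (rule mult_right_mono[OF A(2)]) simp
  also have "\<dots> \<le> inverse ((real (Suc m))\<^sup>2)"
    using divide_right_mono[OF B, of "(real (Suc m))\<^sup>2"] by (simp add: power_divide inverse_eq_divide)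
  finally show "norm (1 / eigval \<delta> (Suc m * N) * (?s / real (Suc m))\<^sup>2) \<le> inverse ((real (Suc m))\<^sup>2)"
    using A by (simp del: of_nat_Suc of_nat_mult mult_Suc add: abs_mult)
qed

lemma bubbleF_nonneg:
  assumes "0 \<le> \<delta>" "1 \<le> N"
  shows "0 \<le> bubbleF N \<delta> \<omega>"
  unfolding bubbleF_def using assms
  by (intro suminf_nonneg summable_bubbleF mult_nonneg_nonneg) (auto simp: eigval_def)

lemma Nstar_largest_minimizer:
  assumes "0 < \<gamma>" "0 \<le> \<delta>"
  shows "is_arg_min (energy \<omega> \<gamma> \<delta>) (\<lambda>N. 1 \<le> N) (Nstar \<omega> \<gamma> \<delta>)"
    and "is_arg_min (energy \<omega> \<gamma> \<delta>) (\<lambda>N. 1 \<le> N) N \<Longrightarrow> N \<le> Nstar \<omega> \<gamma> \<delta>"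
proof -
  let ?E = "energy \<omega> \<gamma> \<delta>"
  define K where "K = nat \<lceil>?E 1\<rceil> + 1"
  have lb: "2 * real N \<le> ?E N" if "1 \<le> N" for N
    using bubbleF_nonneg[of \<delta> N \<omega>] assms that by (simp add: energy_def)
  have big: "?E 1 < ?E N" if "K < N" for N
    using lb[of N] that unfolding K_def by linarith
  define M where "M = arg_min_on ?E {1..K}"
  have K: "{1..K} \<noteq> {}" by (simp add: K_def)
  have M: "M \<in> {1..K}" "\<And>y. y \<in> {1..K} \<Longrightarrow> ?E M \<le> ?E y"
    unfolding M_def using arg_min_if_finite(1)[OF _ K] arg_min_least[OF _ K] by auto
  have "\<not> ?E y < ?E M" if "1 \<le> y" for y
    using M(2)[of y] M(2)[of 1] big[of y] that K by (cases "y \<le> K") force+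
  then have ex: "is_arg_min ?E (\<lambda>N. 1 \<le> N) M"
    using M(1) by (auto simp: is_arg_min_def)
  have bd: "N \<le> K" if "is_arg_min ?E (\<lambda>N. 1 \<le> N) N" for N
    using that big[of N] by (force simp: is_arg_min_def not_less)
  show "is_arg_min ?E (\<lambda>N. 1 \<le> N) (Nstar \<omega> \<gamma> \<delta>)"
    unfolding Nstar_def using ex bd by (rule GreatestI_nat)
  show "N \<le> Nstar \<omega> \<gamma> \<delta>" if "is_arg_min ?E (\<lambda>N. 1 \<le> N) N"
    unfolding Nstar_def using that bd by (rule Greatest_le_nat)
qed

end

theory Submission
  imports Defs
begin

text \<open>
  Writing \<open>c m = (sin (m\<pi>\<omega>) / m)\<^sup>2 \<ge> 0\<close>, termwise differentiation gives
  \<open>\<partial>F(N;\<delta>)/\<partial>\<delta> = - (\<Sum>m\<ge>1. c m / (\<delta> + m\<^sup>2 N\<^sup>2)\<^sup>2)\<close>. Every summand \<open>c m / (\<delta> + m\<^sup>2 N\<^sup>2)\<^sup>2\<close> decreases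
  in \<open>N\<close>, so \<open>F(N';\<delta>) - F(N;\<delta>)\<close> has a nonnegative derivative in \<open>\<delta>\<close> whenever
  \<open>1 \<le> N \<le> N'\<close> (\<open>bubbleF_diff_deriv\<close>). Taking \<open>N' = N + 1\<close> gives the instant inequality on
  \<open>DeltaF\<close>, and integrating it from \<open>0\<close> gives the cumulative one.

  The monotonicity of the minimizer is the usual consequence of such increasing differences
  (\<open>largest_arg_min_antimono\<close>): raising \<open>\<delta>\<close> makes every move to a larger \<open>N\<close> less
  profitable, so it cannot raise the largest minimizer. The differences are taken between arbitrary
  \<open>N \<le> N'\<close> because two minimizers may lie more than one step apart.

  The differentiation is carried out for \<open>\<delta> > -1\<close>, which contains the endpoint \<open>\<delta> = 0\<close>
  in its interior; the denominators stay positive there because \<open>m\<^sup>2 N\<^sup>2 \<ge> 1\<close>.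
\<close>

text \<open>These are the weights \<open>c\<close>, shifted so that index \<open>0\<close> stands for \<open>m = 1\<close>.\<close>

definition bubble_weight :: "real \<Rightarrow> nat \<Rightarrow> real" where
  "bubble_weight \<omega> m = (sin (real (Suc m) * pi * \<omega>) / real (Suc m))\<^sup>2"

lemma bubble_weight_nonneg: "0 \<le> bubble_weight \<omega> m"
  by (simp add: bubble_weight_def)

lemma summable_bubble_weight: "summable (bubble_weight \<omega>)"
proof (rule summable_comparison_test')
  show "summable (\<lambda>m. inverse ((real (Suc m))\<^sup>2))"
    using summable_Suc_iff[of "\<lambda>m. inverse ((real m)\<^sup>2)"] inverse_power_summable[of 2, where 'a = real]
    by simp
  fix m :: nat
  have "(sin (real (Suc m) * pi * \<omega>))\<^sup>2 \<le> 1" by (simp add: abs_square_le_1)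
  then show "norm (bubble_weight \<omega> m) \<le> inverse ((real (Suc m))\<^sup>2)"
    unfolding bubble_weight_def power_divide
    by (simp add: inverse_eq_divide divide_right_mono del: of_nat_Suc)
qed

lemma bubbleF_eq: "bubbleF N \<delta> \<omega> = (\<Sum>m. bubble_weight \<omega> m / eigval \<delta> (Suc m * N))"
  by (simp add: bubbleF_def bubble_weight_def)

lemma eigval_lower_bound:
  assumes "1 \<le> N"
  shows "\<delta> + 1 \<le> eigval \<delta> (Suc m * N)"
proof -
  have "1 \<le> Suc m * N" using assms by simp
  then have "1 \<le> real (Suc m * N)" by linarith
  then show ?thesis
    using one_le_power[of "real (Suc m * N)" 2] unfolding eigval_def by linarith
qed

lemma eigval_mono:
  assumes "n \<le> n'"
  shows "eigval \<delta> n \<le> eigval \<delta> n'"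
  using assms by (simp add: eigval_def power_mono)

lemma summable_weight_over:
  assumes "0 < q" and "\<And>m. q \<le> e m"
  shows "summable (\<lambda>m. bubble_weight \<omega> m / e m)"
proof (rule summable_comparison_test')
  show "summable (\<lambda>m. bubble_weight \<omega> m / q)"
    by (intro summable_divide summable_bubble_weight)
  fix m
  have "0 < e m" using assms by (meson less_le_trans)
  then show "norm (bubble_weight \<omega> m / e m) \<le> bubble_weight \<omega> m / q"
    using assms bubble_weight_nonneg[of \<omega> m] by (simp add: frac_le)
qed

lemma summable_bubbleF_deriv:
  assumes "1 \<le> N" and "-1 < \<delta>"
  shows "summable (\<lambda>m. bubble_weight \<omega> m / (eigval \<delta> (Suc m * N))\<^sup>2)"
proof (rule summable_weight_over)
  show "0 < (\<delta> + 1)\<^sup>2" using assms by simp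
  show "(\<delta> + 1)\<^sup>2 \<le> (eigval \<delta> (Suc m * N))\<^sup>2" for m
    using assms eigval_lower_bound[of N \<delta> m] by (intro power_mono) auto
qed

text \<open>
  On an interval around \<open>\<delta>\<close> that stays away from \<open>-1\<close> the denominators have a common lower
  bound \<open>q > 0\<close>, which makes the \<open>m\<close>-th summand Lipschitz with constant \<open>c m / q\<^sup>2\<close>. These
  constants are summable, and this permits exchanging derivative and sum.
\<close>

lemma bubbleF_has_derivative:
  assumes N: "1 \<le> N" and \<delta>: "-1 < \<delta>"
  shows "((\<lambda>d. bubbleF N d \<omega>) has_real_derivative
           - (\<Sum>m. bubble_weight \<omega> m / (eigval \<delta> (Suc m * N))\<^sup>2)) (at \<delta>)"
proof -
  let ?c = "bubble_weight \<omega>"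
  define q where "q = (\<delta> + 1) / 2"
  have q: "0 < q" using \<delta> by (simp add: q_def)
  let ?I = "{(\<delta> - 1) / 2<..<\<delta> + 1}"
  have e: "q \<le> eigval d (Suc m * N)" if "d \<in> ?I" for d m
  proof -
    have "q \<le> d + 1" using that by (simp add: q_def field_simps)
    then show ?thesis using eigval_lower_bound[OF N, of d m] by linarith
  qed
  have e0: "0 < eigval d (Suc m * N)" if "d \<in> ?I" for d m
    using e[OF that, of m] q by linarith
  have mem: "\<delta> \<in> ?I" using \<delta> by (simp add: field_simps)
  have "((\<lambda>d. \<Sum>m. ?c m / eigval d (Suc m * N)) has_real_derivative
           (\<Sum>m. - (?c m / (eigval \<delta> (Suc m * N))\<^sup>2))) (at \<delta>)"
  proof (rule DERIV_series'[where f = "\<lambda>d m. ?c m / eigval d (Suc m * N)"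
        and f' = "\<lambda>d m. - (?c m / (eigval d (Suc m * N))\<^sup>2)" and L = "\<lambda>m. ?c m / q\<^sup>2"])
    show "((\<lambda>d. ?c m / eigval d (Suc m * N)) has_real_derivative
            - (?c m / (eigval \<delta> (Suc m * N))\<^sup>2)) (at \<delta>)" for m
      using e0[OF mem, of m] unfolding eigval_def
      by (auto intro!: derivative_eq_intros simp: power2_eq_square)
    show "summable (\<lambda>m. ?c m / eigval d (Suc m * N))" if "d \<in> ?I" for d
      using summable_weight_over[OF q] e[OF that] .
    show "\<delta> \<in> ?I" by (rule mem)
    show "summable (\<lambda>m. - (?c m / (eigval \<delta> (Suc m * N))\<^sup>2))"
      by (intro summable_minus summable_bubbleF_deriv N \<delta>)
    show "summable (\<lambda>m. ?c m / q\<^sup>2)"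
      by (intro summable_divide summable_bubble_weight)
    fix m x y assume x: "x \<in> ?I" and y: "y \<in> ?I"
    let ?X = "eigval x (Suc m * N)" and ?Y = "eigval y (Suc m * N)"
    have pos: "0 < ?X" "0 < ?Y" using e0 x y by blast+
    have "?c m / ?X - ?c m / ?Y = ?c m * (?Y - ?X) / (?X * ?Y)"
      using pos by (simp only: diff_frac_eq less_imp_neq[THEN not_sym] right_diff_distrib not_False_eq_True)
    also have "?Y - ?X = y - x" by (simp add: eigval_def)
    finally have "\<bar>?c m / ?X - ?c m / ?Y\<bar> = ?c m * \<bar>x - y\<bar> / (?X * ?Y)"
      using pos bubble_weight_nonneg[of \<omega> m] by (simp add: abs_mult abs_minus_commute)
    also have "\<dots> \<le> ?c m * \<bar>x - y\<bar> / q\<^sup>2"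
      using e[OF x, of m] e[OF y, of m] q bubble_weight_nonneg[of \<omega> m]
      by (intro frac_le) (auto simp: power2_eq_square intro!: mult_mono)
    finally show "\<bar>?c m / ?X - ?c m / ?Y\<bar> \<le> ?c m / q\<^sup>2 * \<bar>x - y\<bar>" by simp
  qed
  moreover have "(\<Sum>m. - (?c m / (eigval \<delta> (Suc m * N))\<^sup>2)) = - (\<Sum>m. ?c m / (eigval \<delta> (Suc m * N))\<^sup>2)"
    by (intro suminf_minus summable_bubbleF_deriv N \<delta>)
  ultimately show ?thesis by (simp only: bubbleF_eq)
qed

text \<open>
  The rate \<open>c m / (\<delta> + m\<^sup>2 N\<^sup>2)\<^sup>2\<close> at which screening weakens the \<open>m\<close>-th summand is smaller for
  finer splittings, so the energy gained by splitting shrinks as \<open>\<delta>\<close> grows.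
\<close>

lemma bubbleF_diff_deriv:
  assumes N: "1 \<le> N" "N \<le> N'" and \<delta>: "-1 < \<delta>"
  shows "\<exists>D\<ge>0. ((\<lambda>d. bubbleF N' d \<omega> - bubbleF N d \<omega>) has_real_derivative D) (at \<delta>)"
proof -
  let ?R = "\<lambda>N. \<Sum>m. bubble_weight \<omega> m / (eigval \<delta> (Suc m * N))\<^sup>2"
  have N': "1 \<le> N'" using N by simp
  have "?R N' \<le> ?R N"
  proof (rule suminf_le)
    fix m
    have "0 < eigval \<delta> (Suc m * N)" using eigval_lower_bound[OF N(1), of \<delta> m] \<delta> by linarith
    moreover have "eigval \<delta> (Suc m * N) \<le> eigval \<delta> (Suc m * N')"
      using N by (intro eigval_mono mult_le_mono2)
    ultimately show "bubble_weight \<omega> m / (eigval \<delta> (Suc m * N'))\<^sup>2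
                       \<le> bubble_weight \<omega> m / (eigval \<delta> (Suc m * N))\<^sup>2"
      by (intro divide_left_mono power_mono bubble_weight_nonneg mult_pos_pos zero_less_power) auto
  qed (use N N' \<delta> in \<open>simp_all only: summable_bubbleF_deriv\<close>)
  moreover have "((\<lambda>d. bubbleF N' d \<omega> - bubbleF N d \<omega>) has_real_derivative - ?R N' - - ?R N) (at \<delta>)"
    by (intro DERIV_diff bubbleF_has_derivative N N' \<delta>)
  ultimately show ?thesis by (intro exI[of _ "- ?R N' - - ?R N"]) simp
qed

lemma bubbleF_diff_mono:
  assumes "1 \<le> N" "N \<le> N'" and "-1 < \<delta>" "\<delta> \<le> \<delta>'"
  shows "bubbleF N' \<delta> \<omega> - bubbleF N \<delta> \<omega> \<le> bubbleF N' \<delta>' \<omega> - bubbleF N \<delta>' \<omega>"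
proof (rule DERIV_nonneg_imp_nondecreasing[where f = "\<lambda>d. bubbleF N' d \<omega> - bubbleF N d \<omega>"])
  show "\<delta> \<le> \<delta>'" by fact
  fix d assume "\<delta> \<le> d"
  then have "-1 < d" using assms by linarith
  from bubbleF_diff_deriv[OF assms(1,2) this]
  show "\<exists>D. ((\<lambda>d. bubbleF N' d \<omega> - bubbleF N d \<omega>) has_real_derivative D) (at d) \<and> 0 \<le> D"
    by blast
qed

lemma energy_diff_mono:
  assumes "0 < \<gamma>" "1 \<le> N" "N \<le> N'" "-1 < \<delta>" "\<delta> \<le> \<delta>'"
  shows "energy \<omega> \<gamma> \<delta> N' - energy \<omega> \<gamma> \<delta> N \<le> energy \<omega> \<gamma> \<delta>' N' - energy \<omega> \<gamma> \<delta>' N"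
proof -
  have "2 * \<gamma> / pi * (bubbleF N' \<delta> \<omega> - bubbleF N \<delta> \<omega>)
          \<le> 2 * \<gamma> / pi * (bubbleF N' \<delta>' \<omega> - bubbleF N \<delta>' \<omega>)"
    using assms by (intro mult_left_mono bubbleF_diff_mono) auto
  then show ?thesis by (simp add: energy_def right_diff_distrib)
qed

text \<open>
  If the minimizer \<open>b\<close> of \<open>g\<close> exceeded \<open>a\<close>, then moving from \<open>a\<close> to \<open>b\<close> would not
  raise \<open>g\<close>, hence by increasing differences not raise \<open>f\<close> either, and \<open>b\<close> would be a
  minimizer of \<open>f\<close> beyond the largest one.
\<close>

lemma largest_arg_min_antimono:
  fixes f g :: "'a::linorder \<Rightarrow> 'b::linordered_ab_group_add"
  assumes incr: "\<And>x y. P x \<Longrightarrow> P y \<Longrightarrow> x \<le> y \<Longrightarrow> f y - f x \<le> g y - g x"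
    and a: "is_arg_min f P a" and a_largest: "\<And>x. is_arg_min f P x \<Longrightarrow> x \<le> a"
    and b: "is_arg_min g P b"
  shows "b \<le> a"
proof (rule ccontr)
  assume "\<not> b \<le> a"
  then have "f b - f a \<le> g b - g a" using a b by (intro incr) (auto simp: is_arg_min_def)
  also have "\<dots> \<le> 0" using a b by (auto simp: is_arg_min_def not_less)
  finally have "f b \<le> f a" by simp
  then have "is_arg_min f P b" using a b by (fastforce simp: is_arg_min_def)
  then show False using a_largest \<open>\<not> b \<le> a\<close> by blast
qed

lemma Nstar_antimono:
  assumes "0 < \<gamma>" "0 \<le> \<delta>" "\<delta> \<le> \<delta>'"
  shows "Nstar \<omega> \<gamma> \<delta>' \<le> Nstar \<omega> \<gamma> \<delta>"
proof (rule largest_arg_min_antimono[where P = "\<lambda>N. 1 \<le> N"])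
  show "energy \<omega> \<gamma> \<delta> y - energy \<omega> \<gamma> \<delta> x \<le> energy \<omega> \<gamma> \<delta>' y - energy \<omega> \<gamma> \<delta>' x"
    if "1 \<le> x" "1 \<le> y" "x \<le> y" for x y
    using that assms by (intro energy_diff_mono) auto
  show "is_arg_min (energy \<omega> \<gamma> \<delta>) (\<lambda>N. 1 \<le> N) (Nstar \<omega> \<gamma> \<delta>)"
    and "is_arg_min (energy \<omega> \<gamma> \<delta>) (\<lambda>N. 1 \<le> N) x \<Longrightarrow> x \<le> Nstar \<omega> \<gamma> \<delta>" for x
    using assms by (intro Nstar_largest_minimizer; simp)+
  show "is_arg_min (energy \<omega> \<gamma> \<delta>') (\<lambda>N. 1 \<le> N) (Nstar \<omega> \<gamma> \<delta>')"
    using assms by (intro Nstar_largest_minimizer) auto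
qed

theorem corollary3p3:
  fixes \<omega> :: real
  assumes "0 < \<omega>" and "\<omega> < 1 / 2"
  shows "instantly_demotes \<omega> \<and> cumulatively_demotes \<omega>"
proof
  have pos: "1 \<le> Nstar \<omega> \<gamma> \<delta>" if "0 < \<gamma>" "0 \<le> \<delta>" for \<gamma> \<delta>
    using Nstar_largest_minimizer(1)[OF that] by (simp add: is_arg_min_def)
  have deriv: "\<exists>D\<ge>0. ((\<lambda>d. DeltaF N d \<omega>) has_real_derivative D) (at \<delta>)" if "1 \<le> N" "0 < \<delta>" for N \<delta>
    unfolding DeltaF_def using that by (intro bubbleF_diff_deriv) auto
  have cumul: "0 \<le> DeltaF N \<delta> \<omega> - DeltaF N 0 \<omega>" if "1 \<le> N" "0 < \<delta>" for N \<delta>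
    using bubbleF_diff_mono[of N "N + 1" 0 \<delta> \<omega>] that by (simp add: DeltaF_def)
  show "instantly_demotes \<omega>"
    unfolding instantly_demotes_def
  proof (intro allI impI conjI ballI monotone_onI deriv)
    show "Nstar \<omega> \<gamma> \<delta>' \<le> Nstar \<omega> \<gamma> \<delta>"
      if "0 < \<gamma>" "\<delta> \<in> {0<..<3}" "\<delta> \<le> \<delta>'" for \<gamma> \<delta> \<delta>'
      using that by (intro Nstar_antimono) auto
  qed (use pos in auto)
  show "cumulatively_demotes \<omega>"
    unfolding cumulatively_demotes_def
    by (intro allI impI conjI ballI cumul Nstar_antimono) (use pos in auto)
qed

end
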